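(* There exists an absolute constant $c$ such that for all sufficiently large $b_1$ the following holds. Let $m=\prod_{p\ \mathrm{prime},\ b_1\le p\le c\,b_1} p$. Then the number of integers between $1$ and $m-1$ which have a prime factor $p$ with $b_1\le p\le c\,b_1$, which equals $$(m-1)-m\prod_{p\ \mathrm{prime},\ b_1\le p\le c\,b_1}\Bigl(1-\frac1p\Bigr),$$ is greater than $\dfrac{m}{\ln b_1}$.
   Context: $\ln$ denotes the natural logarithm. "Absolute constant" means that $c$ does not depend on $b_1$. *)

theory Defs
  imports Complex_Main "HOL-Computational_Algebra.Primes"
begin

definition primes_in_interval :: "real \<Rightarrow> real \<Rightarrow> nat set" where
  "primes_in_interval a b = {p. prime p \<and> a \<le> real p \<and> real p \<le> b}"

end

theory Submission
  imports Defs "HOL-Number_Theory.Totient"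
begin

text \<open>
  The integers up to \<open>m\<close> coprime to \<open>m\<close> number \<open>totient m\<close>, and \<open>m\<close> is squarefree with set of prime
  factors \<open>P\<close>, the primes in \<open>[b, c b]\<close>. So the counting formula is the product formula for the totient
  (\<open>card_multiple_of_some_prime\<close>), provided that \<open>P\<close> is nonempty: otherwise \<open>m = 1\<close>, and the formula
  would give \<open>-1\<close> instead of \<open>0\<close>.

  What remains is to make the proportion \<open>1 - (\<Prod>p\<in>P. 1 - 1 / p)\<close> exceed \<open>1 / ln b + 1 / m\<close>. Since
  \<open>1 - 1 / p\<close> is the inverse of \<open>1 + 1 / (p - 1)\<close>, the product is at most \<open>1 / (1 + T)\<close> with
  \<open>T = (\<Sum>p\<in>P. 1 / (p - 1))\<close> (\<open>prod_one_minus_inverse_le\<close>). It therefore suffices that \<open>T\<close> is at least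
  \<open>3 / ln (c b)\<close>: then the proportion is at least \<open>3 / (ln b + O(1))\<close>, which beats \<open>2 / ln b\<close>, while
  \<open>m \<ge> b\<close> makes \<open>1 / m\<close> at most \<open>1 / ln b\<close>.

  The bound on \<open>T\<close> is Mertens' first theorem in disguise. The sum of \<open>ln p / (p - 1)\<close> over the primes up
  to \<open>n\<close> is \<open>ln n + O(1)\<close>, so over \<open>[b, c b]\<close> it is at least \<open>ln c - O(1)\<close>
  (\<open>sum_ln_over_prime_minus_1_interval_ge\<close>), which is at least \<open>3\<close> for a suitable constant \<open>c\<close>; and each
  \<open>ln p\<close> is at most \<open>ln (c b)\<close>. Both sides of Mertens' estimate come from comparing
  \<open>ln (n!) = n ln n + O(n)\<close> with its prime factorization, in which \<open>p\<close> occurs between \<open>n / p - 1\<close> and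
  \<open>n / (p - 1)\<close> times. The lower estimate is immediate with the weights \<open>ln p / (p - 1)\<close>; the upper one
  also needs Chebyshev's bound \<open>\<theta>(n) \<le> n ln 4\<close> to absorb the term \<open>-1\<close>, and the convergence of the sum of
  \<open>ln k / (k (k - 1))\<close> to pass from \<open>ln p / p\<close> to \<open>ln p / (p - 1)\<close>.
\<close>

section \<open>Chebyshev's upper bound\<close>

abbreviation primes_upto :: "nat \<Rightarrow> nat set" where
  "primes_upto n \<equiv> {p. prime p \<and> p \<le> n}"

lemma prod_distinct_primes_dvd:
  fixes k :: nat
  assumes "finite A" "\<And>p. p \<in> A \<Longrightarrow> prime p \<and> p dvd k"
  shows "\<Prod>A dvd k"
  using assms
proof (induction A rule: finite_induct)
  case (insert q A)
  have "coprime q (\<Prod>A)"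
    using insert.hyps insert.prems by (intro prod_coprime_right) (auto intro: primes_coprime)
  with insert show ?case by (auto intro: divides_mult)
qed auto

text \<open>
  Erdos's argument: for \<open>n = 2 m + 1\<close> every prime in \<open>(m + 1, 2 m + 1]\<close> divides \<open>2 m + 1 choose m\<close>, which is
  at most \<open>4 ^ m\<close> because the lower half of its row of binomial coefficients sums to \<open>2 ^ (2 m)\<close>.
\<close>
lemma primorial_le: "\<Prod>(primes_upto n) \<le> 4 ^ n"
proof (induction n rule: less_induct)
  case (less n)
  consider "n \<le> 1" | "n = 2" | "n > 2" "even n" | "n > 2" "odd n" by linarith
  then show ?case
  proof cases
    case 1
    then have *: "primes_upto n = {}" by (auto dest: prime_ge_2_nat)
    show ?thesis unfolding * by simp
  next
    case 2
    then have *: "primes_upto n = {2}" by (auto dest: prime_ge_2_nat intro: antisym)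
    show ?thesis unfolding * using 2 by simp
  next
    case 3
    then have "\<not> prime n" using prime_odd_nat by blast
    then have "primes_upto n = primes_upto (n - 1)"
      using 3 by (auto simp: le_less) 
    moreover have "(4::nat) ^ (n - 1) \<le> 4 ^ n" by (intro power_increasing) auto
    moreover have "\<Prod>(primes_upto (n - 1)) \<le> 4 ^ (n - 1)" using less[of "n - 1"] 3 by simp
    ultimately show ?thesis by (metis order_trans)
  next
    case 4
    then obtain m where n: "n = 2 * m + 1" by (auto elim: oddE)
    define Q where "Q = {p. prime p \<and> m + 1 < p \<and> p \<le> n}"
    have "p dvd (2 * m + 1 choose m)" if "p \<in> Q" for p
    proof -
      have p: "prime p" "m + 1 < p" "p \<le> 2 * m + 1" using that by (auto simp: Q_def n)
      have "p dvd fact m * fact (2 * m + 1 - m) * (2 * m + 1 choose m)"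
        using p by (subst binomial_fact_lemma) (auto simp: prime_dvd_fact_iff simp del: fact_Suc)
      then show ?thesis
        using p by (auto simp: prime_dvd_mult_iff prime_dvd_fact_iff simp del: fact_Suc)
    qed
    then have "\<Prod>Q dvd (2 * m + 1 choose m)"
      by (intro prod_distinct_primes_dvd) (auto simp: Q_def)
    then have "\<Prod>Q \<le> (2 * m + 1 choose m)"
      by (rule dvd_imp_le) simp
    also have "\<dots> \<le> (\<Sum>k\<le>m. 2 * m + 1 choose k)"
      by (rule member_le_sum) auto
    also have "\<dots> = 4 ^ m"
      unfolding binomial_r_part_sum by (simp add: power_mult)
    finally have Q: "\<Prod>Q \<le> 4 ^ m" .
    have "primes_upto n = primes_upto (m + 1) \<union> Q" using n by (auto simp: Q_def)
    moreover have "\<Prod>(primes_upto (m + 1) \<union> Q) = \<Prod>(primes_upto (m + 1)) * \<Prod>Q"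
      by (rule prod.union_disjoint) (auto simp: Q_def)
    moreover have "\<Prod>(primes_upto (m + 1)) \<le> 4 ^ (m + 1)" using less[of "m + 1"] n 4 by auto
    ultimately have "\<Prod>(primes_upto n) \<le> 4 ^ (m + 1) * 4 ^ m"
      using Q by (simp only: mult_le_mono)
    also have "\<dots> = 4 ^ n" by (simp add: n power_add[symmetric])
    finally show ?thesis .
  qed
qed

lemma theta_le: "(\<Sum>p\<in>primes_upto n. ln (real p)) \<le> real n * ln 4"
proof -
  have "(\<Sum>p\<in>primes_upto n. ln (real p)) = ln (real (\<Prod>(primes_upto n)))"
    unfolding of_nat_prod by (rule ln_prod[symmetric]) (auto simp: prime_gt_0_nat)
  also have "\<dots> \<le> ln (real (4 ^ n))"
    using primorial_le[of n] by (subst ln_le_cancel_iff)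
      (auto intro!: prod_pos prime_gt_0_nat simp del: of_nat_power of_nat_prod)
  finally show ?thesis by (simp add: ln_realpow)
qed

section \<open>Prime factorization of factorials\<close>

lemma card_multiples:
  assumes "d > 0" shows "card {i \<in> {1..n}. d dvd i} = n div d"
proof -
  have "{i \<in> {1..n}. d dvd i} = (\<lambda>j. d * j) ` {1..n div d}"
    using assms by (auto simp: less_eq_div_iff_mult_less_eq mult.commute image_iff dvd_def Suc_le_eq)
  also have "card \<dots> = n div d" using assms by (subst card_image) (auto simp: inj_on_def)
  finally show ?thesis .
qed

lemma multiplicity_eq_card:
  fixes p i n :: nat
  assumes "prime p" "0 < i" "i \<le> n"
  shows "multiplicity p i = card {k \<in> {1..n}. p ^ k dvd i}"
proof -
  have "k \<le> n" if "p ^ k dvd i" for k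
  proof -
    have "k < p ^ k" using assms(1) by (intro power_gt_expt) (auto dest: prime_gt_1_nat)
    also have "\<dots> \<le> i" using that assms by (auto intro: dvd_imp_le)
    finally show ?thesis using assms by simp
  qed
  then have "{k \<in> {1..n}. p ^ k dvd i} = {1..multiplicity p i}"
    using assms by (auto simp: power_dvd_iff_le_multiplicity dest: prime_gt_1_nat)
  then show ?thesis by simp
qed

text \<open>
  Legendre's formula, by counting the pairs \<open>(i, k)\<close> with \<open>p ^ k dvd i\<close> and \<open>i \<le> n\<close> in two ways. The range
  of \<open>k\<close> may stop at \<open>n\<close> because \<open>n < p ^ n\<close>.
\<close>
lemma multiplicity_fact:
  fixes p :: nat
  assumes "prime p"
  shows "multiplicity p (fact n :: nat) = (\<Sum>k=1..n. n div p ^ k)"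
proof -
  have "multiplicity p (fact n :: nat) = (\<Sum>i\<in>{1..n}. multiplicity p i)"
    unfolding fact_prod using assms by (simp add: prime_elem_multiplicity_prod_distrib del: Num.of_nat_simps)
  also have "\<dots> = (\<Sum>i\<in>{1..n}. \<Sum>k | k \<in> {1..n} \<and> p ^ k dvd i. 1)"
    using assms by (intro sum.cong refl) (simp add: multiplicity_eq_card[of p _ n])
  also have "\<dots> = (\<Sum>k\<in>{1..n}. \<Sum>i | i \<in> {1..n} \<and> p ^ k dvd i. 1)"
    by (rule sum.swap_restrict) auto
  also have "\<dots> = (\<Sum>k=1..n. n div p ^ k)"
    using assms by (intro sum.cong refl) (simp add: card_multiples[simplified] prime_gt_0_nat)
  finally show ?thesis .
qed

text \<open>
  The terms of Legendre's formula are dominated by a geometric series.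
\<close>
lemma multiplicity_fact_le:
  fixes p :: nat
  assumes "prime p"
  shows "real (multiplicity p (fact n :: nat)) \<le> real n / (real p - 1)"
proof -
  have p: "real p > 1" using assms prime_gt_1_nat by simp
  have "real (multiplicity p (fact n :: nat)) \<le> (\<Sum>k=1..n. real n / real p ^ k)"
    unfolding multiplicity_fact[OF assms] of_nat_sum
    by (intro sum_mono) (metis of_nat_div_le_of_nat of_nat_power)
  also have "\<dots> = real n * (\<Sum>k=1..n. (1 / real p) ^ k)"
    by (simp add: sum_distrib_left power_divide)
  also have "(\<Sum>k=1..n. (1 / real p) ^ k) \<le> 1 / (real p - 1)"
  proof -
    have "(\<Sum>k=1..n. (1 / real p) ^ k) * (real p - 1) = 1 - (1 / real p) ^ n"
    proof (induction n)
      case (Suc n)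
      have "(1 / real p) ^ Suc n * (real p - 1) = (1 / real p) ^ n - (1 / real p) ^ Suc n"
        using p by (simp add: field_simps)
      with Suc show ?case by (simp add: distrib_right)
    qed auto
    also have "\<dots> \<le> 1" using p by simp
    finally show ?thesis using p by (simp add: pos_le_divide_eq)
  qed
  finally show ?thesis by (simp add: mult_left_mono)
qed

lemma multiplicity_fact_ge:
  fixes p :: nat
  assumes "prime p" "p \<le> n"
  shows "real n / real p - 1 \<le> real (multiplicity p (fact n :: nat))"
proof -
  have "n \<ge> 1" using assms prime_gt_0_nat[of p] by linarith
  have "real n / real p - 1 \<le> real (n div p)"
    using floor_divide_of_nat_eq[of n p, where 'a = real] by linarith
  also have "n div p = (\<Sum>k\<in>{1}. n div p ^ k)" by simp
  also have "(\<Sum>k\<in>{1}. n div p ^ k) \<le> (\<Sum>k=1..n. n div p ^ k)"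
    using \<open>n \<ge> 1\<close> by (intro sum_mono2) auto
  finally show ?thesis using multiplicity_fact[OF assms(1), of n] by simp
qed

lemma ln_fact_eq:
  "ln (fact n) = (\<Sum>p\<in>primes_upto n. real (multiplicity p (fact n :: nat)) * ln (real p))"
proof -
  have pf: "prime_factors (fact n :: nat) = primes_upto n"
    by (auto simp: prime_factors_dvd prime_dvd_fact_iff)
  have "ln (fact n) = ln (real (fact n))" by simp
  also have "(fact n :: nat) = (\<Prod>p\<in>primes_upto n. p ^ multiplicity p (fact n :: nat))"
    using prime_factorization_nat[of "fact n"] pf by simp
  also have "ln (real \<dots>) = (\<Sum>p\<in>primes_upto n. real (multiplicity p (fact n :: nat)) * ln (real p))"
    unfolding of_nat_prod of_nat_power
    by (subst ln_prod) (auto simp: ln_realpow prime_gt_0_nat)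
  finally show ?thesis .
qed

section \<open>Mertens' estimates for sums over primes\<close>

text \<open>
  Bounding the multiplicity of \<open>p\<close> in \<open>n!\<close> from below by \<open>n / p - 1\<close> costs the sum of all \<open>ln p\<close> with \<open>p \<le> n\<close>,
  which Chebyshev's bound controls.
\<close>
lemma sum_ln_over_prime_le:
  assumes "n \<ge> 1"
  shows "(\<Sum>p\<in>primes_upto n. ln (real p) / real p) \<le> ln (real n) + ln 4"
proof -
  have "(\<Sum>p\<in>primes_upto n. (real n / real p - 1) * ln (real p)) \<le> ln (fact n)"
    unfolding ln_fact_eq
    by (intro sum_mono mult_right_mono multiplicity_fact_ge) (auto simp: ln_ge_zero prime_ge_Suc_0_nat)
  also have "\<dots> \<le> ln (real n ^ n)"
    using assms fact_le_power[of n, where 'a = real] by simp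
  also have "\<dots> = real n * ln (real n)" using assms by (simp add: ln_realpow)
  finally have "real n * (\<Sum>p\<in>primes_upto n. ln (real p) / real p)
      \<le> real n * ln (real n) + (\<Sum>p\<in>primes_upto n. ln (real p))"
    by (simp add: sum_distrib_left left_diff_distrib sum_subtractf)
  also have "\<dots> \<le> real n * (ln (real n) + ln 4)"
    using theta_le[of n] by (simp add: distrib_left)
  finally show ?thesis using assms by simp
qed

lemma ln_Suc_le:
  assumes "n > 0"
  shows "ln (real (Suc n)) \<le> ln (real n) + 1 / real n"
proof -
  have "real (Suc n) = real n * (1 + 1 / real n)" using assms by (simp add: field_simps)
  then have "ln (real (Suc n)) = ln (real n) + ln (1 + 1 / real n)"
    using assms by (metis add_pos_nonneg divide_nonneg_nonneg ln_mult_pos of_nat_0_le_iff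
        of_nat_0_less_iff zero_le_one zero_less_one)
  also have "ln (1 + 1 / real n) \<le> 1 / real n" by (rule ln_add_one_self_le_self) simp
  finally show ?thesis by simp
qed

lemma ln_fact_ge: "real n * ln (real n) - real n \<le> ln (fact n)"
proof (induction n)
  case (Suc n)
  show ?case
  proof (cases "n = 0")
    case False
    have "real n * ln (real (Suc n)) \<le> real n * ln (real n) + 1"
      using False ln_Suc_le[of n] by (simp add: field_simps)
    moreover have "ln (fact (Suc n) :: real) = ln (real (Suc n)) + ln (fact n)"
      unfolding fact_Suc by (rule ln_mult_pos) auto
    moreover have "real (Suc n) * ln (real (Suc n)) = real n * ln (real (Suc n)) + ln (real (Suc n))"
      by (simp add: distrib_right)
    ultimately show ?thesis using Suc by simp
  qed auto
qed auto

text \<open>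
  The weights \<open>ln p / (p - 1)\<close>, rather than \<open>ln p / p\<close>, account for the higher powers of \<open>p\<close> dividing \<open>n!\<close>;
  they are also the ones that match \<open>1 / (1 - 1 / p) = 1 + 1 / (p - 1)\<close>.
\<close>
lemma sum_ln_over_prime_minus_1_ge:
  assumes "n \<ge> 1"
  shows "ln (real n) - 1 \<le> (\<Sum>p\<in>primes_upto n. ln (real p) / (real p - 1))"
proof -
  have "real n * (ln (real n) - 1) \<le> ln (fact n)"
    using ln_fact_ge[of n] by (simp add: right_diff_distrib)
  also have "\<dots> \<le> (\<Sum>p\<in>primes_upto n. real n / (real p - 1) * ln (real p))"
    unfolding ln_fact_eq
    by (intro sum_mono mult_right_mono multiplicity_fact_le) (auto simp: ln_ge_zero prime_ge_Suc_0_nat)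
  also have "\<dots> = real n * (\<Sum>p\<in>primes_upto n. ln (real p) / (real p - 1))"
    by (simp add: sum_distrib_left)
  finally show ?thesis using assms by simp
qed

text \<open>
  The right-hand side is chosen to make the induction telescope: \<open>(ln x + 1) / x\<close> has the derivative
  \<open>- ln x / x\<^sup>2\<close>, and the numerator \<open>ln x + 2\<close> instead leaves room for the error of replacing the sum by
  an integral. The point of the bound is that it is uniform in \<open>n\<close>.
\<close>
lemma sum_ln_over_pronic_le:
  assumes "n \<ge> 1"
  shows "(\<Sum>k=2..n. ln (real k) / (real k * (real k - 1))) \<le> 2 - (ln (real n) + 2) / real n"
  using assms
proof (induction n rule: nat_induct_at_least)
  case (Suc n)
  have n: "real n > 0" using Suc by simp
  have "(real n + 1) * ln (real (Suc n)) \<le> (real n + 1) * (ln (real n) + 1 / real n)"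
    using n by (intro mult_left_mono ln_Suc_le) auto
  also have "\<dots> \<le> (real n + 1) * ln (real n) + 2"
    using Suc by (simp add: field_simps)
  finally have "ln (real (Suc n)) \<le> (real n + 1) * (ln (real n) + 2) - real n * (ln (real (Suc n)) + 2)"
    by (simp add: algebra_simps)
  then have "ln (real (Suc n)) / (real (Suc n) * real n)
      \<le> ((real n + 1) * (ln (real n) + 2) - real n * (ln (real (Suc n)) + 2)) / (real (Suc n) * real n)"
    by (intro divide_right_mono) auto
  also have "\<dots> = (ln (real n) + 2) / real n - (ln (real (Suc n)) + 2) / real (Suc n)"
    using n by (simp add: diff_divide_distrib add.commute)
  finally have "ln (real (Suc n)) / (real (Suc n) * real n)
      \<le> (ln (real n) + 2) / real n - (ln (real (Suc n)) + 2) / real (Suc n)" .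
  then show ?case using Suc by (simp add: sum.atLeast_Suc_atMost)
qed auto

lemma sum_ln_over_prime_minus_1_le:
  assumes "n \<ge> 1"
  shows "(\<Sum>p\<in>primes_upto n. ln (real p) / (real p - 1)) \<le> ln (real n) + ln 4 + 2"
proof -
  have "ln (real p) / (real p - 1) = ln (real p) / real p + ln (real p) / (real p * (real p - 1))"
    if "p \<in> primes_upto n" for p
  proof -
    have "real p > 1" using that prime_gt_1_nat by simp
    then show ?thesis by (simp add: divide_simps) (simp add: algebra_simps)
  qed
  then have "(\<Sum>p\<in>primes_upto n. ln (real p) / (real p - 1)) =
     (\<Sum>p\<in>primes_upto n. ln (real p) / real p) + (\<Sum>p\<in>primes_upto n. ln (real p) / (real p * (real p - 1)))"
    by (simp add: sum.distrib)
  also have "(\<Sum>p\<in>primes_upto n. ln (real p) / (real p * (real p - 1)))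
     \<le> (\<Sum>k=2..n. ln (real k) / (real k * (real k - 1)))"
    by (intro sum_mono2) (auto dest: prime_ge_2_nat)
  also have "\<dots> \<le> 2"
  proof -
    have "(ln (real n) + 2) / real n \<ge> 0" using assms by (intro divide_nonneg_nonneg add_nonneg_nonneg) auto
    then show ?thesis using sum_ln_over_pronic_le[OF assms] by linarith
  qed
  finally show ?thesis using sum_ln_over_prime_le[OF assms] by linarith
qed

text \<open>
  The lower estimate up to \<open>c b\<close> minus the upper estimate below \<open>b\<close>: the two terms \<open>ln b\<close> cancel.
\<close>
lemma sum_ln_over_prime_minus_1_interval_ge:
  assumes "b \<ge> 2" "c \<ge> 1"
  shows "ln c - ln 2 - ln 4 - 3 \<le> (\<Sum>p\<in>primes_in_interval b (c * b). ln (real p) / (real p - 1))"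
proof -
  define n where "n = nat \<lfloor>c * b\<rfloor>"
  (* k is the largest integer strictly below b: b itself may be a prime of the interval *)
  define k where "k = nat (\<lceil>b\<rceil> - 1)"
  have cb: "c * b \<ge> b" using assms by simp
  have nlt: "real p \<le> c * b \<longleftrightarrow> p \<le> n" for p
    unfolding n_def using cb assms by (simp add: le_nat_floor le_floor_iff nat_le_iff le_nat_iff)
  have klt: "b \<le> real p \<longleftrightarrow> \<not> p \<le> k" for p
    unfolding k_def using assms by linarith
  have k: "k \<ge> 1" "real k \<le> b" unfolding k_def using assms by linarith+
  (* rounding c * b down loses at most a factor 2, which costs ln 2 in the final bound *)
  have n: "n \<ge> 1" "c * b / 2 \<le> real n" unfolding n_def using assms cb by linarith+
  have kn: "k \<le> n" using nlt[of k] k cb by linarith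
  have P: "primes_in_interval b (c * b) = primes_upto n - primes_upto k"
    unfolding primes_in_interval_def nlt klt by auto
  have "(\<Sum>p\<in>primes_in_interval b (c * b). ln (real p) / (real p - 1))
     = (\<Sum>p\<in>primes_upto n. ln (real p) / (real p - 1)) - (\<Sum>p\<in>primes_upto k. ln (real p) / (real p - 1))"
    unfolding P using kn by (intro sum_diff) auto
  moreover have "ln c + ln b - ln 2 \<le> ln (real n)"
  proof -
    have "ln c + ln b - ln 2 = ln (c * b / 2)" using assms by (simp add: ln_mult_pos ln_div)
    also have "\<dots> \<le> ln (real n)" using n assms by (subst ln_le_cancel_iff) auto
    finally show ?thesis .
  qed
  moreover have "ln (real k) \<le> ln b" using k assms by simp
  ultimately show ?thesis using sum_ln_over_prime_minus_1_ge[OF n(1)] sum_ln_over_prime_minus_1_le[OF k(1)] by linarith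
qed

section \<open>The sieve density\<close>

lemma one_plus_sum_le_prod:
  fixes f :: "'a \<Rightarrow> real"
  assumes "\<And>x. x \<in> A \<Longrightarrow> f x \<ge> 0"
  shows "1 + (\<Sum>x\<in>A. f x) \<le> (\<Prod>x\<in>A. 1 + f x)"
  using assms
proof (induction A rule: infinite_finite_induct)
  case (insert x A)
  have "(\<Prod>x\<in>A. 1 + f x) \<ge> 1" using insert.prems by (intro prod_ge_1) auto
  then have "f x * 1 \<le> f x * (\<Prod>x\<in>A. 1 + f x)"
    using insert.prems by (intro mult_left_mono) auto
  with insert show ?case by (simp add: distrib_right)
qed auto

lemma prod_one_minus_inverse_le:
  assumes "\<And>p. p \<in> P \<Longrightarrow> p \<ge> (2::nat)"
  shows "(\<Prod>p\<in>P. 1 - 1 / real p) \<le> 1 / (1 + (\<Sum>p\<in>P. 1 / (real p - 1)))"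
proof (cases "finite P")
  case True
  have "(\<Prod>p\<in>P. 1 - 1 / real p) = (\<Prod>p\<in>P. inverse (1 + 1 / (real p - 1)))"
  proof (intro prod.cong refl)
    fix p assume "p \<in> P"
    then have "real p \<ge> 2" using assms by force
    then show "1 - 1 / real p = inverse (1 + 1 / (real p - 1))" by (simp add: field_simps)
  qed
  also have "\<dots> = 1 / (\<Prod>p\<in>P. 1 + 1 / (real p - 1))"
    by (simp add: prod_dividef inverse_eq_divide)
  also have "\<dots> \<le> 1 / (1 + (\<Sum>p\<in>P. 1 / (real p - 1)))"
  proof (rule divide_left_mono)
    have nn: "1 / (real p - 1) \<ge> 0" if "p \<in> P" for p using assms[OF that] by simp
    show "1 + (\<Sum>p\<in>P. 1 / (real p - 1)) \<le> (\<Prod>p\<in>P. 1 + 1 / (real p - 1))"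
      using nn by (rule one_plus_sum_le_prod)
    have "(\<Sum>p\<in>P. 1 / (real p - 1)) \<ge> 0" using nn by (rule sum_nonneg)
    moreover have "(\<Prod>p\<in>P. 1 + 1 / (real p - 1)) > 0" using nn by (intro prod_pos) (auto intro: add_pos_nonneg)
    ultimately show "0 < (\<Prod>p\<in>P. 1 + 1 / (real p - 1)) * (1 + (\<Sum>p\<in>P. 1 / (real p - 1)))" by simp
  qed auto
  finally show ?thesis .
qed auto

text \<open>
  Nonemptiness makes \<open>m > 1\<close>, so that all of the \<open>totient m\<close> coprime residues lie in \<open>{1..m - 1}\<close>.
\<close>
lemma card_multiple_of_some_prime:
  fixes P :: "nat set"
  assumes "finite P" "P \<noteq> {}" and prime: "\<And>p. p \<in> P \<Longrightarrow> prime p"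
  defines "m \<equiv> \<Prod>P"
  shows "real (card {n \<in> {1..m - 1}. \<exists>p\<in>P. p dvd n}) = (real m - 1) - real m * (\<Prod>p\<in>P. 1 - 1 / real p)"
proof -
  have m0: "m > 0" unfolding m_def using prime by (auto intro!: prod_pos intro: prime_gt_0_nat)
  obtain q where "q \<in> P" using assms by blast
  then have "q dvd m" unfolding m_def using assms by auto
  then have m1: "m > 1" using m0 prime[OF \<open>q \<in> P\<close>] 
    by (metis One_nat_def Suc_lessI nat_dvd_1_iff_1 not_prime_1)
  have pdvd: "p dvd m \<longleftrightarrow> p \<in> P" if "prime p" for p
    unfolding m_def prime_dvd_prod_iff[OF \<open>finite P\<close> that]
    using that prime by (metis dvd_refl primes_dvd_imp_eq)
  have cop: "\<not> coprime n m \<longleftrightarrow> (\<exists>p\<in>P. p dvd n)" for n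
  proof
    assume "\<not> coprime n m"
    then have "gcd n m \<noteq> 1" by (simp add: coprime_iff_gcd_eq_1)
    then obtain p where "prime p" "p dvd gcd n m" using prime_factor_nat by blast
    then have "prime p" "p dvd n" "p dvd m" by simp_all
    then show "\<exists>p\<in>P. p dvd n" using pdvd by blast
  next
    assume "\<exists>p\<in>P. p dvd n"
    then show "\<not> coprime n m" using pdvd prime by (metis coprime_common_divisor not_prime_unit)
  qed
  have "totatives m \<subseteq> {1..m - 1}"
  proof
    fix n assume "n \<in> totatives m"
    then show "n \<in> {1..m - 1}" using totatives_less[of n m] m1 by (force simp: in_totatives_iff)
  qed
  then have split: "{1..m - 1} = {n \<in> {1..m - 1}. \<exists>p\<in>P. p dvd n} \<union> totatives m"
    by (auto simp: in_totatives_iff cop[symmetric])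
  have "card {1..m - 1} = card {n \<in> {1..m - 1}. \<exists>p\<in>P. p dvd n} + card (totatives m)"
    by (subst split, rule card_Un_disjoint) (auto simp: in_totatives_iff cop[symmetric])
  then have "m - 1 = card {n \<in> {1..m - 1}. \<exists>p\<in>P. p dvd n} + totient m"
    by (simp only: card_atLeastAtMost diff_Suc_1' totient_def add_diff_cancel_right' Suc_eq_plus1)
  then have "real (card {n \<in> {1..m - 1}. \<exists>p\<in>P. p dvd n}) = real m - 1 - real (totient m)"
    using m0 by linarith
  moreover have "prime_factors m = P"
    using pdvd m0 prime by (auto simp: prime_factors_dvd)
  ultimately show ?thesis by (simp add: totient_formula2)
qed

theorem mainTheorem2:
  "\<exists>c::real. \<forall>\<^sub>F b\<^sub>1::real in at_top.
     (let P = primes_in_interval b\<^sub>1 (c * b\<^sub>1);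
          m = \<Prod>P;
          N = card {n \<in> {1..m - 1}. \<exists>p\<in>P. p dvd n}
      in real N = (real m - 1) - real m * (\<Prod>p\<in>P. 1 - 1 / real p) \<and>
         real N > real m / ln b\<^sub>1)"
proof -
  (* c = exp K, where K exceeds by 3 the constant lost in the sum over the interval *)
  define K :: real where "K = 6 + ln 2 + ln 4"
  have K: "K > 0" unfolding K_def by (simp add: add_pos_nonneg)
  have "\<forall>\<^sub>F b in at_top. b \<ge> 2 \<and> ln b > 2 * K + 6"
    by (intro eventually_conj eventually_ge_at_top filterlim_at_top_dense[THEN iffD1, rule_format, OF ln_at_top])
  then have "\<forall>\<^sub>F b in at_top.
     (let P = primes_in_interval b (exp K * b);
          m = \<Prod>P;
          N = card {n \<in> {1..m - 1}. \<exists>p\<in>P. p dvd n}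
      in real N = (real m - 1) - real m * (\<Prod>p\<in>P. 1 - 1 / real p) \<and>
         real N > real m / ln b)"
  proof (rule eventually_mono)
    fix b :: real assume "b \<ge> 2 \<and> ln b > 2 * K + 6"
    then have b: "b \<ge> 2" and L: "ln b > 2 * K + 6" by auto
    define P where "P = primes_in_interval b (exp K * b)"
    define m where "m = \<Prod>P"
    define N where "N = card {n \<in> {1..m - 1}. \<exists>p\<in>P. p dvd n}"
    define T where "T = (\<Sum>p\<in>P. 1 / (real p - 1))"
    have lncb: "ln (exp K * b) = K + ln b" using b by (simp add: ln_mult_pos)
    have P: "prime p" "b \<le> real p" "real p \<le> exp K * b" if "p \<in> P" for p
      using that by (auto simp: P_def primes_in_interval_def)
    have "P \<subseteq> {..nat \<lfloor>exp K * b\<rfloor>}" using P(3) by (auto intro: le_nat_floor)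
    then have fin: "finite P" by (rule finite_subset) simp
    have "3 \<le> (\<Sum>p\<in>P. ln (real p) / (real p - 1))"
      using sum_ln_over_prime_minus_1_interval_ge[OF b, of "exp K"] K by (simp add: P_def K_def)
    also have "\<dots> \<le> (\<Sum>p\<in>P. (K + ln b) * (1 / (real p - 1)))"
    proof (rule sum_mono)
      fix p assume p: "p \<in> P"
      have "real p \<ge> 2" using b P(2)[OF p] by linarith
      then have "ln (real p) \<le> K + ln b" using P(3)[OF p] lncb ln_mono[of "real p" "exp K * b"] by simp
      then show "ln (real p) / (real p - 1) \<le> (K + ln b) * (1 / (real p - 1))"
        using \<open>real p \<ge> 2\<close> by (simp add: divide_right_mono)
    qed
    also have "\<dots> = (K + ln b) * T" by (simp add: T_def sum_distrib_left)
    finally have T: "3 \<le> (K + ln b) * T" .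
    then have "P \<noteq> {}" by (auto simp: T_def)
    have N: "real N = (real m - 1) - real m * (\<Prod>p\<in>P. 1 - 1 / real p)"
      unfolding N_def m_def by (rule card_multiple_of_some_prime[OF fin \<open>P \<noteq> {}\<close> P(1)])
    obtain q where q: "q \<in> P" using \<open>P \<noteq> {}\<close> by blast
    have m0: "m > 0" unfolding m_def using P(1) by (auto intro!: prod_pos intro: prime_gt_0_nat)
    have "q dvd m" unfolding m_def using fin q by auto
    then have "q \<le> m" using m0 by (rule dvd_imp_le)
    then have "b \<le> real m" using P(2)[OF q] by linarith
    then have m: "ln b \<le> real m" using b ln_le_minus_one[of b] by linarith
    have "T > 0" using T K L by (smt (verit) zero_less_mult_pos)
    have "3 / (K + ln b) \<le> T" using T L K by (simp add: field_simps)
    have "(\<Prod>p\<in>P. 1 - 1 / real p) \<le> 1 / (1 + T)"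
      unfolding T_def using P(1) by (intro prod_one_minus_inverse_le prime_ge_2_nat) 
    also have "\<dots> \<le> 1 / (1 + 3 / (K + ln b))"
      using \<open>3 / (K + ln b) \<le> T\<close> K L by (intro divide_left_mono mult_pos_pos add_pos_pos) (auto simp: \<open>T > 0\<close>)
    also have "\<dots> < 1 - 2 / ln b"
      using K L by (simp add: field_simps)
    finally have "real m * (\<Prod>p\<in>P. 1 - 1 / real p) < real m * (1 - 2 / ln b)"
      using m0 by simp
    moreover have "1 \<le> real m / ln b" using m K L by simp
    ultimately have "real N > real m / ln b" unfolding N by (simp add: right_diff_distrib)
    with N show "let P = primes_in_interval b (exp K * b);
          m = \<Prod>P;
          N = card {n \<in> {1..m - 1}. \<exists>p\<in>P. p dvd n}
      in real N = (real m - 1) - real m * (\<Prod>p\<in>P. 1 - 1 / real p) \<and>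
         real N > real m / ln b"
      unfolding Let_def N_def m_def P_def by blast
  qed
  then show ?thesis by blast
qed

end
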